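(* The class of optimization problems $S(t_0,x_0)$ with supremum terms in the objective, defined in the context, does not satisfy the principle of optimality. That is, there exist data $n,m,T,t_0,X,U,f,(c_t),(d_t)$ as in the context, times $s,t$ with $t_0\le t<s<T$, and sequences $\mathbf{u}^*=(u(t),\dots,u(T-1))$, $\mathbf{x}^*=(x(t),\dots,x(T))$ that solve $S(t,x(t))$, such that $\mathbf{v}=(u(s),\dots,u(T-1))$ and $\mathbf{h}=(x(s),\dots,x(T))$ do not solve $S(s,x(s))$.
   Context: Data: $T\in\mathbb{N}$, $t_0\in\{0,\dots,T-1\}$, $X\subset\mathbb{R}^n$, $U\subset\mathbb{R}^m$, $f:\mathbb{R}^n\times\mathbb{R}^m\times\mathbb{N}\to\mathbb{R}^n$, $c_t:\mathbb{R}^n\times\mathbb{R}^m\to\mathbb{R}$ for $t=t_0,\dots,T-1$, $c_T:\mathbb{R}^n\to\mathbb{R}$, and $d_t:\mathbb{R}^n\to\mathbb{R}$ for $t=t_0,\dots,T$. For $t\in\{t_0,\dots,T-1\}$ and an initial state $x_0$, $S(t,x_0)$ is the problem of minimizing $$J_{t,x_0}(\mathbf{u},\mathbf{x})=\sum_{k=t}^{T-1}c_k(x(k),u(k))+c_T(x(T))+\sup_{t\le k\le T}d_k(x(k))$$ over $\mathbf{u}=(u(t),\dots,u(T-1))$ and $\mathbf{x}=(x(t),\dots,x(T))$ subject to $x(t)=x_0$; $x(k+1)=f[x(k),u(k),k]$ for $k=t,\dots,T-1$; $x(k)\in X$ for $k=t,\dots,T$; $u(k)\in U$ for $k=t,\dots,T-1$.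 A pair solves $S(t,x_0)$ if it is feasible and attains the minimum of $J_{t,x_0}$ over feasible pairs. Standing assumption: for all $x\in X$ and all $t$ the set $\{u\in U: f[x,u,t]\in X\}$ is nonempty. *)

theory Defs
  imports Complex_Main "HOL-Library.FuncSet" "Jordan_Normal_Form.Matrix"
begin

(* R^n is carrier_vec n :: real vec set, so that n and m can be quantified as
   numbers. Only the values of f, c, cT and d on these carriers matter: every
   state and input below lies in X resp. U. *)

definition control_data ::
    "nat \<Rightarrow> nat \<Rightarrow> nat \<Rightarrow> nat \<Rightarrow> real vec set \<Rightarrow> real vec set \<Rightarrow>
     (real vec \<Rightarrow> real vec \<Rightarrow> nat \<Rightarrow> real vec) \<Rightarrow> bool" where
  "control_data n m T t0 X U f \<longleftrightarrow>
     0 < n \<and> 0 < m \<and> t0 < T \<and>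
     X \<subseteq> carrier_vec n \<and> U \<subseteq> carrier_vec m \<and>
     (\<forall>x\<in>carrier_vec n. \<forall>u\<in>carrier_vec m. \<forall>k. f x u k \<in> carrier_vec n) \<and>
     (\<forall>x\<in>X. \<forall>k. {u \<in> U. f x u k \<in> X} \<noteq> {})"

definition cost ::
    "nat \<Rightarrow> (nat \<Rightarrow> real vec \<Rightarrow> real vec \<Rightarrow> real) \<Rightarrow> (real vec \<Rightarrow> real) \<Rightarrow>
     (nat \<Rightarrow> real vec \<Rightarrow> real) \<Rightarrow> nat \<Rightarrow> (nat \<Rightarrow> real vec) \<Rightarrow> (nat \<Rightarrow> real vec) \<Rightarrow> real" where
  "cost T c cT d t u x =
     (\<Sum>k=t..<T. c k (x k) (u k)) + cT (x T) + (SUP k\<in>{t..T}. d k (x k))"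

(* Finite sequences (u(t),...,u(T-1)) and (x(t),...,x(T)) are extensional
   functions on {t..<T} and {t..T}, hence determined by their entries. *)

definition feasible ::
    "nat \<Rightarrow> real vec set \<Rightarrow> real vec set \<Rightarrow> (real vec \<Rightarrow> real vec \<Rightarrow> nat \<Rightarrow> real vec) \<Rightarrow>
     nat \<Rightarrow> real vec \<Rightarrow> (nat \<Rightarrow> real vec) \<Rightarrow> (nat \<Rightarrow> real vec) \<Rightarrow> bool" where
  "feasible T X U f t x0 u x \<longleftrightarrow>
     u \<in> {t..<T} \<rightarrow>\<^sub>E U \<and> x \<in> {t..T} \<rightarrow>\<^sub>E X \<and>
     x t = x0 \<and> (\<forall>k\<in>{t..<T}. x (Suc k) = f (x k) (u k) k)"

definition solves ::
    "nat \<Rightarrow> real vec set \<Rightarrow> real vec set \<Rightarrow> (real vec \<Rightarrow> real vec \<Rightarrow> nat \<Rightarrow> real vec) \<Rightarrow>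
     (nat \<Rightarrow> real vec \<Rightarrow> real vec \<Rightarrow> real) \<Rightarrow> (real vec \<Rightarrow> real) \<Rightarrow> (nat \<Rightarrow> real vec \<Rightarrow> real) \<Rightarrow>
     nat \<Rightarrow> real vec \<Rightarrow> (nat \<Rightarrow> real vec) \<Rightarrow> (nat \<Rightarrow> real vec) \<Rightarrow> bool" where
  "solves T X U f c cT d t x0 u x \<longleftrightarrow>
     feasible T X U f t x0 u x \<and>
     (\<forall>v h. feasible T X U f t x0 v h \<longrightarrow> cost T c cT d t u x \<le> cost T c cT d t v h)"

end

theory Submission
  imports Defs
begin

text \<open>
  The supremum remembers the past: a large value of \<open>d\<close> at the initial state masks every later
  value, so moving to a state where \<open>d\<close> is large costs nothing extra. Once the initial state is
  dropped, the tail problem no longer has this mask, and the same move becomes expensive.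

  The example is one-dimensional, time-invariant and has horizon 2. States and inputs range over
  \<open>{0, 1}\<close>, the input is the next state, \<open>d\<close> and the running cost are the state itself, and the
  terminal cost rewards ending in 1 by 1/2. Starting from the state 1 at time 0, the supremum is 1
  along every trajectory, so the total cost is \<open>2 + x(1) - x(2)/2\<close> and the unique optimum is
  \<open>x = (1, 0, 1)\<close>. Starting from the state 0 at time 1, the supremum is \<open>x(2)\<close>, so the total cost is
  \<open>x(2)/2\<close>: the tail \<open>(0, 1)\<close> costs 1/2, whereas staying at 0 costs 0. Since the optimum is unique,
  the failure does not come from an unfortunate choice among several minimizers.
\<close>

definition scalar_vec :: "real \<Rightarrow> real vec" where
  "scalar_vec a = vec 1 (\<lambda>_. a)"

definition binary_vecs :: "real vec set" where
  "binary_vecs = {scalar_vec 0, scalar_vec 1}"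

abbreviation state_cost :: "real vec \<Rightarrow> real" where
  "state_cost x \<equiv> x $ 0"

abbreviation example_cost :: "nat \<Rightarrow> (nat \<Rightarrow> real vec) \<Rightarrow> (nat \<Rightarrow> real vec) \<Rightarrow> real" where
  "example_cost \<equiv> cost 2 (\<lambda>_ x _. state_cost x) (\<lambda>x. - state_cost x / 2) (\<lambda>_. state_cost)"

abbreviation example_feasible ::
    "nat \<Rightarrow> real vec \<Rightarrow> (nat \<Rightarrow> real vec) \<Rightarrow> (nat \<Rightarrow> real vec) \<Rightarrow> bool" where
  "example_feasible \<equiv> feasible 2 binary_vecs binary_vecs (\<lambda>_ u _. u)"

abbreviation example_solves ::
    "nat \<Rightarrow> real vec \<Rightarrow> (nat \<Rightarrow> real vec) \<Rightarrow> (nat \<Rightarrow> real vec) \<Rightarrow> bool" where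
  "example_solves \<equiv> solves 2 binary_vecs binary_vecs (\<lambda>_ u _. u)
     (\<lambda>_ x _. state_cost x) (\<lambda>x. - state_cost x / 2) (\<lambda>_. state_cost)"

lemma scalar_vec_index [simp]: "scalar_vec a $ 0 = a"
  by (simp add: scalar_vec_def)

lemma binary_vecs_iff: "x \<in> binary_vecs \<longleftrightarrow> x = scalar_vec 0 \<or> x = scalar_vec 1"
  by (auto simp: binary_vecs_def)

lemma control_data_example:
  "control_data 1 1 2 0 binary_vecs binary_vecs (\<lambda>_ u _. u)"
  by (auto simp: control_data_def binary_vecs_def scalar_vec_def)

lemma example_cost_0:
  "example_cost 0 u x =
     state_cost (x 0) + state_cost (x 1) - state_cost (x 2) / 2
       + max (state_cost (x 0)) (max (state_cost (x 1)) (state_cost (x 2)))"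
proof -
  have "{0..<2} = {0, 1::nat}" "{0..2} = {0, 1, 2::nat}" by auto
  then show ?thesis by (simp add: cost_def cSup_eq_Max)
qed

lemma example_cost_1:
  "example_cost 1 u x =
     state_cost (x 1) - state_cost (x 2) / 2 + max (state_cost (x 1)) (state_cost (x 2))"
proof -
  have "{1..<2} = {1::nat}" "{1..2} = {1, 2::nat}" by auto
  then show ?thesis by (simp add: cost_def cSup_eq_Max)
qed

definition optimal_input :: "nat \<Rightarrow> real vec" where
  "optimal_input = (\<lambda>k\<in>{0..<2}. if k = 0 then scalar_vec 0 else scalar_vec 1)"

definition optimal_state :: "nat \<Rightarrow> real vec" where
  "optimal_state = (\<lambda>k\<in>{0..2}. if k = 1 then scalar_vec 0 else scalar_vec 1)"

lemma optimal_state_simps [simp]: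
  "optimal_state 0 = scalar_vec 1" "optimal_state (Suc 0) = scalar_vec 0"
  "optimal_state 2 = scalar_vec 1"
  by (simp_all add: optimal_state_def)

text \<open>
  Every feasible trajectory starts in 1, which is the largest value of \<open>d\<close>, so the remaining
  freedom is to make \<open>x(1)\<close> small and \<open>x(2)\<close> large.
\<close>

lemma optimal_solves: "example_solves 0 (scalar_vec 1) optimal_input optimal_state"
  unfolding solves_def
proof (intro conjI allI impI)
  show "example_feasible 0 (scalar_vec 1) optimal_input optimal_state"
    by (auto simp: feasible_def optimal_input_def optimal_state_def binary_vecs_iff)
next
  fix v h
  assume "example_feasible 0 (scalar_vec 1) v h"
  then have "h 0 = scalar_vec 1" "h 1 \<in> binary_vecs" "h 2 \<in> binary_vecs"
    by (auto simp: feasible_def)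
  then show "example_cost 0 optimal_input optimal_state \<le> example_cost 0 v h"
    unfolding example_cost_0 by (auto simp: binary_vecs_iff)
qed

text \<open>Resting at 0 is feasible for the tail problem and beats the tail of the optimum.\<close>

lemma optimal_tail_not_solves:
  "\<not> example_solves 1 (scalar_vec 0) (restrict optimal_input {1..<2}) (restrict optimal_state {1..2})"
proof
  assume "example_solves 1 (scalar_vec 0) (restrict optimal_input {1..<2}) (restrict optimal_state {1..2})"
  moreover have "example_feasible 1 (scalar_vec 0) (\<lambda>k\<in>{1..<2}. scalar_vec 0) (\<lambda>k\<in>{1..2}. scalar_vec 0)"
    by (auto simp: feasible_def binary_vecs_iff)
  ultimately have "example_cost 1 (restrict optimal_input {1..<2}) (restrict optimal_state {1..2})
      \<le> example_cost 1 (\<lambda>k\<in>{1..<2}. scalar_vec 0) (\<lambda>k\<in>{1..2}. scalar_vec 0)"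
    unfolding solves_def by blast
  then show False unfolding example_cost_1 by simp
qed

theorem lemma2:
  "\<exists>(n::nat) (m::nat) (T::nat) (t0::nat) (X::real vec set) (U::real vec set)
     (f::real vec \<Rightarrow> real vec \<Rightarrow> nat \<Rightarrow> real vec)
     (c::nat \<Rightarrow> real vec \<Rightarrow> real vec \<Rightarrow> real) (cT::real vec \<Rightarrow> real)
     (d::nat \<Rightarrow> real vec \<Rightarrow> real).
     control_data n m T t0 X U f \<and>
     (\<exists>(t::nat) (s::nat) (u::nat \<Rightarrow> real vec) (x::nat \<Rightarrow> real vec).
        t0 \<le> t \<and> t < s \<and> s < T \<and>
        solves T X U f c cT d t (x t) u x \<and>
        \<not> solves T X U f c cT d s (x s) (restrict u {s..<T}) (restrict x {s..T}))"
proof -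
  have "(0::nat) \<le> 0 \<and> (0::nat) < 1 \<and> (1::nat) < 2 \<and>
      example_solves 0 (optimal_state 0) optimal_input optimal_state \<and>
      \<not> example_solves 1 (optimal_state 1) (restrict optimal_input {1..<2}) (restrict optimal_state {1..2})"
    using optimal_solves optimal_tail_not_solves by simp
  with control_data_example show ?thesis by blast
qed

end
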